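(* (ZFC) There exists a completely regular Hausdorff $P$-space of cardinality $\mathfrak{c}=2^{\aleph_0}$ which is not weakly Whyburn.
   Context: A $P$-space is a topological space in which every $G_\delta$ set (countable intersection of open sets) is open. A set $F\subseteq X$ is an almost closed set converging to $x\in X$, written $F\to x$, if $\overline{F}\setminus F=\{x\}$. A space $X$ is weakly Whyburn if for each non-closed set $A\subseteq X$ there are a point $x\in\overline{A}\setminus A$ and a set $F\subseteq A$ with $F\to x$. *)

theory Defs
  imports "HOL-Analysis.Analysis"
begin

definition P_space :: "'a topology \<Rightarrow> bool"
  where "P_space X \<longleftrightarrow> (\<forall>S. gdelta_in X S \<longrightarrow> openin X S)"

(* F \<rightarrow> x in the space X; that x is a point of X follows, as closures lie in topspace X *)
definition almost_closed_converging :: "'a topology \<Rightarrow> 'a set \<Rightarrow> 'a \<Rightarrow> bool"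
  where "almost_closed_converging X F x \<longleftrightarrow>
           F \<subseteq> topspace X \<and> X closure_of F - F = {x}"

definition weakly_Whyburn_space :: "'a topology \<Rightarrow> bool"
  where "weakly_Whyburn_space X \<longleftrightarrow>
           (\<forall>A. A \<subseteq> topspace X \<and> \<not> closedin X A \<longrightarrow>
              (\<exists>x F. x \<in> X closure_of A - A \<and> F \<subseteq> A \<and> almost_closed_converging X F x))"

end

theory Submission
  imports Defs
begin

text \<open>
  Start from a family of functions \<open>e (F, x)\<close>, indexed by all sets \<open>F\<close> and points \<open>x\<close> of a set of
  size continuum, such that countably many of them can be prescribed simultaneously, both inside
  \<open>A\<close> and outside \<open>A\<close>. Modify \<open>e (F, x)\<close> so that it separates \<open>x\<close> from \<open>F\<close>, but do
  so only for the sets \<open>F\<close> that are nowhere dense in the resulting P-space topology. This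
  apparently circular choice is a least fixed point, since enlarging the set of modified indices only
  makes more sets nowhere dense. Induction on the fixed point shows that countably many modified
  coordinates can still be prescribed simultaneously. In the topology of these coordinates the nowhere
  dense sets are closed, while any other subset of \<open>A\<close> is dense in some basic open set, hence
  accumulates at more than one point outside \<open>A\<close>.
\<close>

section \<open>Countably independent families on the reals\<close>

text \<open>A real codes a set of naturals and so, through pairing, a whole sequence of reals. Hence
  parameter spaces built from pairs and sequences can still be indexed by the reals.\<close>

lemma surj_from_real:
  fixes f :: "real \<Rightarrow> 'b" and g :: "real \<Rightarrow> 'c"
  assumes "surj f" "surj g"
  shows "\<exists>h :: real \<Rightarrow> 'b \<times> 'c. surj h"
    and "\<exists>h :: real \<Rightarrow> nat \<Rightarrow> 'b. surj h"
proof -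
  obtain u :: "nat set \<Rightarrow> real" where u: "bij u"
    using nat_sets_eqpoll_reals unfolding eqpoll_def by auto
  define s :: "real \<Rightarrow> nat \<Rightarrow> real" where "s r n = u {m. prod_encode (n, m) \<in> inv u r}" for r n
  have "surj s"
  proof (rule surjI)
    fix q :: "nat \<Rightarrow> real"
    have "s (u {prod_encode (n, m) |n m. m \<in> inv u (q n)}) n = q n" for n
      using u by (auto simp: s_def bij_is_inj bij_is_surj surj_f_inv_f)
    then show "s (u {prod_encode (n, m) |n m. m \<in> inv u (q n)}) = q" ..
  qed
  then have s: "\<exists>r. s r = q" for q
    by (metis surjD)
  have "surj (\<lambda>r. (f (s r 0), g (s r 1)))"
  proof -
    have "\<exists>r. (y, z) = (f (s r 0), g (s r 1))" for y z
    proof -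
      obtain a b where "f a = y" "g b = z"
        using assms by (metis surjD)
      moreover obtain r where "s r = (\<lambda>n. if n = 0 then a else b)"
        using s by blast
      ultimately show ?thesis by (intro exI[of _ r]) simp
    qed
    then show ?thesis by (simp add: surj_def)
  qed
  then show "\<exists>h :: real \<Rightarrow> 'b \<times> 'c. surj h" by blast
  have "surj (\<lambda>r n. f (s r n))"
  proof -
    have "\<exists>r. y = (\<lambda>n. f (s r n))" for y
    proof -
      obtain r where "s r = (\<lambda>n. inv f (y n))"
        using s by blast
      then show ?thesis
        using assms(1) by (intro exI[of _ r]) (simp add: surj_f_inv_f)
    qed
    then show ?thesis by (simp add: surj_def)
  qed
  then show "\<exists>h :: real \<Rightarrow> nat \<Rightarrow> 'b. surj h" by blast
qed

text \<open>There are only countably many pairs of distinct members; \<open>k\<close> enumerates one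
  point from each symmetric difference.\<close>

lemma countable_separating_sequence:
  fixes \<S> :: "'b set set"
  assumes "countable \<S>"
  shows "\<exists>k :: nat \<Rightarrow> 'b. \<forall>S\<in>\<S>. \<forall>T\<in>\<S>. {m. k m \<in> S} = {m. k m \<in> T} \<longrightarrow> S = T"
proof -
  define w where "w S T = (SOME z :: 'b. (z \<in> S) \<noteq> (z \<in> T))" for S T
  have w: "(w S T \<in> S) \<noteq> (w S T \<in> T)" if "S \<noteq> T" for S T
    unfolding w_def using that by (intro someI_ex[of "\<lambda>z. (z \<in> S) \<noteq> (z \<in> T)"]) blast
  \<comment> \<open>The extra point \<open>undefined\<close> keeps \<open>K\<close> nonempty, so
    that \<open>from_nat_into\<close> enumerates exactly \<open>K\<close>.\<close>
  define K where "K = insert undefined ((\<lambda>(S, T). w S T) ` (\<S> \<times> \<S>))"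
  have "countable K" "K \<noteq> {}"
    using assms by (auto simp: K_def)
  then have k: "range (from_nat_into K) = K"
    by (simp add: range_from_nat_into)
  have "S = T" if "S \<in> \<S>" "T \<in> \<S>" "{m. from_nat_into K m \<in> S} = {m. from_nat_into K m \<in> T}" for S T
  proof (rule ccontr)
    assume "S \<noteq> T"
    have "w S T \<in> K"
      using that by (auto simp: K_def)
    then obtain m where "from_nat_into K m = w S T"
      using k by (metis imageE)
    then show False
      using w[OF \<open>S \<noteq> T\<close>] that(3) by (metis mem_Collect_eq)
  qed
  then show ?thesis by blast
qed

text \<open>The Fichtenholz--Kantorovich--Hausdorff construction of an independent family: a point is
  \<open>(k, t, r)\<close>, where the sequence \<open>k\<close> traces sets, \<open>t\<close> lists the traces (with labels) to be
  accepted, and \<open>r\<close> makes uncountably many copies and determines membership in \<open>A\<close>.\<close>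

lemma countably_independent_family_real:
  "\<exists>(e :: real set \<times> real \<Rightarrow> real \<Rightarrow> bool) A. \<forall>S\<in>{A, -A}. \<forall>p Z.
     countable p \<and> single_valued p \<and> countable Z \<longrightarrow> (\<exists>y\<in>S - Z. \<forall>(i, b)\<in>p. e i y = b)"
proof -
  obtain u :: "nat set \<Rightarrow> real" where u: "bij u"
    using nat_sets_eqpoll_reals unfolding eqpoll_def by auto
  then have "surj (inv u)"
    by (simp add: bij_imp_bij_inv bij_is_surj)
  have "surj (\<lambda>r::real. r)"
    by simp
  obtain h1 :: "real \<Rightarrow> nat set \<times> real" where "surj h1"
    using surj_from_real(1)[OF \<open>surj (inv u)\<close> \<open>surj (\<lambda>r. r)\<close>] by blast
  obtain h2 :: "real \<Rightarrow> nat \<Rightarrow> nat set \<times> real" where "surj h2"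
    using surj_from_real(2)[OF \<open>surj h1\<close> \<open>surj h1\<close>] by blast
  obtain h3 :: "real \<Rightarrow> nat \<Rightarrow> real" where "surj h3"
    using surj_from_real(2)[OF \<open>surj (\<lambda>r. r)\<close> \<open>surj (\<lambda>r. r)\<close>] by blast
  obtain h4 :: "real \<Rightarrow> (nat \<Rightarrow> nat set \<times> real) \<times> real" where "surj h4"
    using surj_from_real(1)[OF \<open>surj h2\<close> \<open>surj (\<lambda>r. r)\<close>] by blast
  obtain g :: "real \<Rightarrow> (nat \<Rightarrow> real) \<times> (nat \<Rightarrow> nat set \<times> real) \<times> real" where g: "surj g"
    using surj_from_real(1)[OF \<open>surj h3\<close> \<open>surj h4\<close>] by blast
  define e where "e i y = (case (i, g y) of ((S, x), (k, t, r)) \<Rightarrow> ({m. k m \<in> S}, x) \<in> range t)"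
    for i :: "real set \<times> real" and y
  define A where "A = {y. snd (snd (g y)) > 0}"
  have "\<exists>y\<in>S - Z. \<forall>(i, b)\<in>p. e i y = b"
    if S: "S \<in> {A, -A}" and p: "countable p" "single_valued p" and Z: "countable Z" for S p Z
  proof -
    have "countable (fst ` fst ` p)"
      using p by simp
    from countable_separating_sequence[OF this]
    obtain k :: "nat \<Rightarrow> real"
      where "\<forall>S\<in>fst ` fst ` p. \<forall>T\<in>fst ` fst ` p. {m. k m \<in> S} = {m. k m \<in> T} \<longrightarrow> S = T" ..
    then have k: "\<And>S T. S \<in> fst ` fst ` p \<Longrightarrow> T \<in> fst ` fst ` p \<Longrightarrow> {m. k m \<in> S} = {m. k m \<in> T} \<Longrightarrow> S = T"
      by blast
    have "snd ` fst ` p \<noteq> UNIV"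
      using p uncountable_UNIV_real by (metis countable_image)
    then obtain x0 where x0: "x0 \<notin> snd ` fst ` p"
      by auto
    \<comment> \<open>\<open>W\<close> lists the labelled traces to be accepted. Its default
      element, present for nonemptiness, carries a label that no index of \<open>p\<close> has, so
      it makes no prescribed coordinate true.\<close>
    define W where "W = insert ({}, x0) ((\<lambda>((S, x), b). ({m. k m \<in> S}, x)) ` {z \<in> p. snd z})"
    have "countable W" "W \<noteq> {}"
      using p by (auto simp: W_def)
    then have t: "range (from_nat_into W) = W"
      by (simp add: range_from_nat_into)
    \<comment> \<open>The sign of \<open>r\<close> decides membership in \<open>S\<close>, and
      uncountably many choices leave an \<open>r\<close> not occurring in \<open>Z\<close>.\<close>
    define R where "R = (if S = A then {0<..<1::real} else {-1<..<0})"
    have "uncountable R"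
      by (simp add: R_def uncountable_open_interval)
    then have "\<not> R \<subseteq> (\<lambda>y. snd (snd (g y))) ` Z"
      using Z by (meson countable_image countable_subset)
    then obtain r where r: "r \<in> R" "r \<notin> (\<lambda>y. snd (snd (g y))) ` Z"
      by blast
    obtain y where y: "g y = (k, from_nat_into W, r)"
      using g by (metis surjD)
    have "y \<in> S - Z"
      using r S y by (auto simp: R_def A_def image_iff split: if_splits)
    moreover have "e i y = b" if "(i, b) \<in> p" for i b
    proof -
      obtain T x where i: "i = (T, x)" by force
      have e: "e i y \<longleftrightarrow> ({m. k m \<in> T}, x) \<in> W"
        by (simp add: e_def y i t)
      show ?thesis
      proof (cases b)
        case True
        then have "({m. k m \<in> T}, x) \<in> W"
          unfolding W_def using that i by (auto intro!: image_eqI[where x = "((T, x), b)"])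
        then show ?thesis using True e by simp
      next
        case False
        \<comment> \<open>Wrong acceptance would come from an index of \<open>p\<close> with the
          same label and trace but value \<open>True\<close>; \<open>k\<close> forces it to be
          \<open>i\<close> itself.\<close>
        have "({m. k m \<in> T}, x) \<notin> W"
        proof
          assume "({m. k m \<in> T}, x) \<in> W"
          moreover have "x \<noteq> x0"
            using x0 that i by force
          ultimately obtain T' where T': "((T', x), True) \<in> p" "{m. k m \<in> T} = {m. k m \<in> T'}"
            unfolding W_def by auto
          have "T \<in> fst ` fst ` p" "T' \<in> fst ` fst ` p"
            using that T'(1) i by force+
          then have "T = T'"
            using k T'(2) by blast
          then show False
            using T'(1) that i False p(2) by (auto dest: single_valuedD)
        qed
        then show ?thesis using False e by simp
      qed
    qed
    ultimately show ?thesis by blast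
  qed
  then show ?thesis by blast
qed

section \<open>The topology of separating coordinates\<close>

text \<open>Countable single-valued relations \<open>p\<close> play the role of countable partial functions prescribing
  the values of coordinates.\<close>

locale countably_independent =
  fixes e :: "'a set \<times> 'a \<Rightarrow> 'a \<Rightarrow> bool" and A :: "'a set"
  assumes independent:
    "\<lbrakk>S \<in> {A, -A}; countable p; single_valued p; countable Z\<rbrakk> \<Longrightarrow> \<exists>y\<in>S - Z. \<forall>(i, b)\<in>p. e i y = b"
begin

text \<open>For \<open>x\<close> outside \<open>F\<close>, the coordinate \<open>sep (F, x)\<close>
  is true at \<open>x\<close> and false on \<open>F\<close>; off \<open>F\<close> and
  \<open>x\<close> it is still \<open>e (F, x)\<close>, which is what rescues independence.\<close>

definition sep :: "'a set \<times> 'a \<Rightarrow> 'a \<Rightarrow> bool"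
  where "sep i y \<longleftrightarrow> y \<notin> fst i \<and> (y = snd i \<or> e i y)"

text \<open>Nowhere density: each cylinder can be shrunk to miss \<open>F\<close>. Only
  \<open>q\<close> must have small indices; demanding this of \<open>p\<close> as well would be a
  negative occurrence of \<open>small\<close> and destroy monotonicity.\<close>

inductive small :: "'a set \<Rightarrow> bool" where
  smallI: "(\<And>p. countable p \<Longrightarrow> single_valued p \<Longrightarrow>
     \<exists>q. countable q \<and> single_valued (p \<union> q) \<and> (\<forall>z\<in>q. small (fst (fst z))) \<and>
         (\<forall>y\<in>F. \<exists>z\<in>q. sep (fst z) y \<noteq> snd z)) \<Longrightarrow> small F"

section \<open>Generic points and independence of the modified coordinates\<close>

definition generic :: "(('a set \<times> 'a) \<times> bool) set \<Rightarrow> 'a \<Rightarrow> bool"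
  where "generic p y \<longleftrightarrow> (\<forall>z\<in>p. y \<noteq> snd (fst z) \<and> e (fst z) y = snd z)"

lemma generic_mono: "p \<subseteq> q \<Longrightarrow> generic q y \<Longrightarrow> generic p y"
  by (auto simp: generic_def)

text \<open>The counterpart of \<open>small\<close> for the unmodified functions \<open>e\<close>,
  with arbitrary indices and hence free of circularity.\<close>

definition avoidable :: "'a set \<Rightarrow> bool"
  where "avoidable F \<longleftrightarrow> (\<forall>p. countable p \<longrightarrow> single_valued p \<longrightarrow>
    (\<exists>q. p \<subseteq> q \<and> countable q \<and> single_valued q \<and> (\<forall>y. generic q y \<longrightarrow> y \<notin> F)))"

lemma avoidableE:
  assumes "avoidable F" "countable p" "single_valued p"
  obtains q where "p \<subseteq> q" "countable q" "single_valued q" "\<forall>y. generic q y \<longrightarrow> y \<notin> F"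
  using assms unfolding avoidable_def by meson

text \<open>A Baire category argument: extend the prescription once for each \<open>G n\<close>; the
  union of the increasing chain is again countable and single-valued.\<close>

lemma avoidable_UN_nat:
  fixes G :: "nat \<Rightarrow> 'a set"
  assumes G: "\<And>n. avoidable (G n)"
  shows "avoidable (\<Union>n. G n)"
  unfolding avoidable_def
proof (intro allI impI)
  fix p :: "(('a set \<times> 'a) \<times> bool) set"
  assume p: "countable p" "single_valued p"
  have "\<exists>f. \<forall>n. (countable (f n) \<and> single_valued (f n) \<and> p \<subseteq> f n) \<and>
      (f n \<subseteq> f (Suc n) \<and> (\<forall>y. generic (f (Suc n)) y \<longrightarrow> y \<notin> G n))"
  proof (rule dependent_nat_choice)
    fix q n assume q: "countable q \<and> single_valued q \<and> p \<subseteq> q"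
    then obtain q' where "q \<subseteq> q'" "countable q'" "single_valued q'" "\<forall>y. generic q' y \<longrightarrow> y \<notin> G n"
      using avoidableE[OF G] by metis
    then show "\<exists>q'. (countable q' \<and> single_valued q' \<and> p \<subseteq> q') \<and>
        (q \<subseteq> q' \<and> (\<forall>y. generic q' y \<longrightarrow> y \<notin> G n))"
      using q by (intro exI[of _ q']) auto
  qed (use p in blast)
  then obtain f where f: "\<And>n. countable (f n)" "\<And>n. single_valued (f n)" "\<And>n. p \<subseteq> f n"
      "\<And>n. f n \<subseteq> f (Suc n)" "\<And>n y. generic (f (Suc n)) y \<Longrightarrow> y \<notin> G n"
    by metis
  have mono: "f m \<subseteq> f n" if "m \<le> n" for m n
    using lift_Suc_mono_le[of f] f(4) that by blast
  have "single_valued (\<Union>n. f n)"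
  proof (rule single_valuedI)
    fix i b b' assume "(i, b) \<in> (\<Union>n. f n)" "(i, b') \<in> (\<Union>n. f n)"
    then obtain m n where "(i, b) \<in> f m" "(i, b') \<in> f n"
      by auto
    then have "(i, b) \<in> f (max m n)" "(i, b') \<in> f (max m n)"
      using mono[of m "max m n"] mono[of n "max m n"] by auto
    then show "b = b'"
      by (rule single_valuedD[OF f(2)])
  qed
  moreover have "countable (\<Union>n. f n)"
    using f(1) by simp
  moreover have "p \<subseteq> (\<Union>n. f n)"
    using f(3) by blast
  moreover have "y \<notin> (\<Union>n. G n)" if "generic (\<Union>n. f n) y" for y
  proof -
    have "generic (f (Suc n)) y" for n
      by (rule generic_mono[OF _ that]) auto
    then show ?thesis
      using f(5) by blast
  qed
  ultimately show "\<exists>q. p \<subseteq> q \<and> countable q \<and> single_valued q \<and>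
      (\<forall>y. generic q y \<longrightarrow> y \<notin> (\<Union>n. G n))"
    by (intro exI[of _ "\<Union>n. f n"]) simp
qed

lemma avoidable_Union:
  assumes "countable \<F>" "\<And>F. F \<in> \<F> \<Longrightarrow> avoidable F"
  shows "avoidable (\<Union>\<F>)"
proof (cases "\<F> = {}")
  case True
  then show ?thesis by (auto simp: avoidable_def)
next
  case False
  then have "avoidable (\<Union>n. from_nat_into \<F> n)"
    by (intro avoidable_UN_nat assms from_nat_into)
  then show ?thesis
    using False assms(1) by (simp add: range_from_nat_into)
qed

text \<open>At a generic point avoiding the sets occurring in \<open>q\<close>, the functions \<open>sep\<close> and \<open>e\<close> agree on
  the indices in \<open>q\<close>.\<close>

lemma sep_eq_if_generic:
  "generic q y \<Longrightarrow> z \<in> q \<Longrightarrow> y \<notin> fst (fst z) \<Longrightarrow> sep (fst z) y = snd z"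
  by (auto simp: sep_def generic_def)

text \<open>By rule induction the countably many sets occurring in \<open>q\<close> can be avoided
  simultaneously; at generic points doing so, \<open>sep\<close> takes the values prescribed by
  \<open>q\<close>, and these exclude \<open>F\<close>.\<close>

lemma small_imp_avoidable: "small F \<Longrightarrow> avoidable F"
proof (induction rule: small.induct)
  case (smallI F)
  show ?case
    unfolding avoidable_def
  proof (intro allI impI)
    fix p :: "(('a set \<times> 'a) \<times> bool) set"
    assume p: "countable p" "single_valued p"
    obtain q where q: "countable q" "single_valued (p \<union> q)" "\<forall>y\<in>F. \<exists>z\<in>q. sep (fst z) y \<noteq> snd z"
      and IH: "\<forall>z\<in>q. small (fst (fst z)) \<and> avoidable (fst (fst z))"
      using smallI.IH[OF p] by (elim exE conjE)
    have "avoidable (\<Union>z\<in>q. fst (fst z))"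
      using IH q(1) by (intro avoidable_Union) auto
    moreover have "countable (p \<union> q)"
      using p q by simp
    ultimately obtain q' where q': "p \<union> q \<subseteq> q'" "countable q'" "single_valued q'"
        "\<forall>y. generic q' y \<longrightarrow> y \<notin> (\<Union>z\<in>q. fst (fst z))"
      using q(2) by (rule avoidableE)
    have "y \<notin> F" if y: "generic q' y" for y
    proof -
      have "sep (fst z) y = snd z" if "z \<in> q" for z
        using q'(1) q'(4)[rule_format, OF y] that y by (intro sep_eq_if_generic[of q']) auto
      then show ?thesis
        using q(3) by blast
    qed
    then show "\<exists>q. p \<subseteq> q \<and> countable q \<and> single_valued q \<and> (\<forall>y. generic q y \<longrightarrow> y \<notin> F)"
      using q' by (intro exI[of _ q']) auto
  qed
qed

lemma small_cylinder_nonempty: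
  assumes p: "countable p" "single_valued p" and small: "\<And>z. z \<in> p \<Longrightarrow> small (fst (fst z))"
    and S: "S \<in> {A, -A}" and Z: "countable Z"
  shows "\<exists>y\<in>S - Z. \<forall>z\<in>p. sep (fst z) y = snd z"
proof -
  have "avoidable (\<Union>z\<in>p. fst (fst z))"
    using p(1) small small_imp_avoidable by (intro avoidable_Union) auto
  then obtain q where q: "p \<subseteq> q" "countable q" "single_valued q"
      "\<forall>y. generic q y \<longrightarrow> y \<notin> (\<Union>z\<in>p. fst (fst z))"
    using p by (rule avoidableE)
  \<comment> \<open>Also omitting the points named by the indices of \<open>q\<close> makes the
    point found below generic.\<close>
  have "countable (Z \<union> (snd \<circ> fst) ` q)"
    using Z q by simp
  from independent[OF S q(2,3) this]
  obtain y where "y \<in> S - (Z \<union> (snd \<circ> fst) ` q)" and e: "\<forall>(i, b)\<in>q. e i y = b"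
    by (elim bexE)
  then have y: "y \<in> S" "y \<notin> Z" "y \<notin> (snd \<circ> fst) ` q"
    by auto
  have gen: "generic q y"
    unfolding generic_def using y(3) e by (force simp: image_iff)
  have "sep (fst z) y = snd z" if "z \<in> p" for z
    using q(1) q(4)[rule_format, OF gen] that by (intro sep_eq_if_generic[OF gen]) auto
  then show ?thesis
    using y(1,2) by blast
qed

lemma small_empty: "small {}"
proof (rule smallI)
  fix p :: "(('a set \<times> 'a) \<times> bool) set" assume "countable p" "single_valued p"
  then show "\<exists>q. countable q \<and> single_valued (p \<union> q) \<and> (\<forall>z\<in>q. small (fst (fst z))) \<and>
      (\<forall>y\<in>{}. \<exists>z\<in>q. sep (fst z) y \<noteq> snd z)"
    by (intro exI[of _ "{}"]) simp
qed

lemma small_singleton: "small {x}"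
proof (rule smallI)
  fix p :: "(('a set \<times> 'a) \<times> bool) set" assume p: "countable p" "single_valued p"
  have "countable ((snd \<circ> fst) ` p)"
    using p(1) by simp
  \<comment> \<open>With nothing prescribed, independence just gives a point outside a countable
    set. The index \<open>({}, v)\<close> is then new to \<open>p\<close> and may receive the value
    opposite to that at \<open>x\<close>.\<close>
  from independent[OF _ _ _ this, of A "{}"]
  obtain v where v: "v \<notin> (snd \<circ> fst) ` p"
    by auto
  let ?q = "{(({}, v), \<not> sep ({}, v) x)}"
  have "b = b'" if "(i, b) \<in> p \<union> ?q" "(i, b') \<in> p \<union> ?q" for i b b'
  proof -
    have "(({}, v), c) \<notin> p" for c
      using v by force
    then show ?thesis
      using that single_valuedD[OF p(2), of i b b'] by auto
  qed
  then have "single_valued (p \<union> ?q)"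
    by (intro single_valuedI)
  then show "\<exists>q. countable q \<and> single_valued (p \<union> q) \<and> (\<forall>z\<in>q. small (fst (fst z))) \<and>
      (\<forall>y\<in>{x}. \<exists>z\<in>q. sep (fst z) y \<noteq> snd z)"
    using small_empty by (intro exI[of _ ?q]) auto
qed

section \<open>The P-space topology and its separation properties\<close>

definition agree :: "('a set \<times> 'a) set \<Rightarrow> 'a \<Rightarrow> 'a set"
  where "agree C x = {y. \<forall>i\<in>C. sep i y = sep i x}"

definition admissible :: "('a set \<times> 'a) set \<Rightarrow> bool"
  where "admissible C \<longleftrightarrow> countable C \<and> (\<forall>i\<in>C. small (fst i))"

text \<open>The P-modification of the initial topology of the coordinates with small first
  component: basic sets fix countably many coordinates instead of finitely many.\<close>

definition sep_topology :: "'a topology"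
  where "sep_topology = topology (\<lambda>U. \<forall>x\<in>U. \<exists>C. admissible C \<and> agree C x \<subseteq> U)"

lemma admissible_UN: "countable I \<Longrightarrow> (\<And>i. i \<in> I \<Longrightarrow> admissible (C i)) \<Longrightarrow> admissible (\<Union>i\<in>I. C i)"
  by (auto simp: admissible_def)

lemma agree_mono: "C \<subseteq> D \<Longrightarrow> agree D x \<subseteq> agree C x"
  by (auto simp: agree_def)

lemma agree_refl: "x \<in> agree C x"
  by (simp add: agree_def)

lemma openin_sep_topology:
  "openin sep_topology U \<longleftrightarrow> (\<forall>x\<in>U. \<exists>C. admissible C \<and> agree C x \<subseteq> U)"
proof -
  have "istopology (\<lambda>U. \<forall>x\<in>U. \<exists>C. admissible C \<and> agree C x \<subseteq> U)"
    unfolding istopology_def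
  proof (intro conjI allI impI)
    fix S T :: "'a set"
    assume S: "\<forall>x\<in>S. \<exists>C. admissible C \<and> agree C x \<subseteq> S"
      and T: "\<forall>x\<in>T. \<exists>C. admissible C \<and> agree C x \<subseteq> T"
    show "\<forall>x\<in>S \<inter> T. \<exists>C. admissible C \<and> agree C x \<subseteq> S \<inter> T"
    proof
      fix x assume "x \<in> S \<inter> T"
      then obtain C D where "admissible C" "agree C x \<subseteq> S" "admissible D" "agree D x \<subseteq> T"
        using S T by blast
      then have "admissible (C \<union> D)" "agree (C \<union> D) x \<subseteq> S \<inter> T"
        by (auto simp: admissible_def agree_def)
      then show "\<exists>C. admissible C \<and> agree C x \<subseteq> S \<inter> T" by blast
    qed
  next
    fix \<K> :: "'a set set"
    assume "\<forall>K\<in>\<K>. \<forall>x\<in>K. \<exists>C. admissible C \<and> agree C x \<subseteq> K"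
    then show "\<forall>x\<in>\<Union>\<K>. \<exists>C. admissible C \<and> agree C x \<subseteq> \<Union>\<K>"
      by (meson Sup_upper Union_iff order_trans)
  qed
  then show ?thesis
    by (simp add: sep_topology_def topology_inverse')
qed

lemma topspace_sep_topology [simp]: "topspace sep_topology = UNIV"
proof -
  have "admissible {}"
    by (simp add: admissible_def)
  then have "openin sep_topology UNIV"
    unfolding openin_sep_topology by blast
  then show ?thesis
    using openin_subset by blast
qed

text \<open>For fixed \<open>C\<close> the cylinders partition the space, so this applies to
  complements too and makes cylinders clopen.\<close>

lemma openin_union_of_cylinders:
  assumes "admissible C" "\<And>x y. x \<in> U \<Longrightarrow> y \<in> agree C x \<Longrightarrow> y \<in> U"
  shows "openin sep_topology U"
  unfolding openin_sep_topology using assms by blast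

lemma openin_agree: "admissible C \<Longrightarrow> openin sep_topology (agree C x)"
  by (rule openin_union_of_cylinders) (auto simp: agree_def)

lemma completely_regular_sep_topology: "completely_regular_space sep_topology"
  unfolding completely_regular_space_def
proof (intro allI impI)
  fix S x assume "closedin sep_topology S \<and> x \<in> topspace sep_topology - S"
  then have "openin sep_topology (UNIV - S)" "x \<in> UNIV - S"
    by (auto simp: closedin_def)
  then obtain C where C: "admissible C" "agree C x \<subseteq> UNIV - S"
    unfolding openin_sep_topology by blast
  define f where "f y = (if y \<in> agree C x then 0 else 1 :: real)" for y
  have "continuous_map sep_topology (top_of_set {0..1}) f"
    unfolding continuous_map_openin_preimage_eq
  proof (intro conjI allI impI)
    fix V :: "real set"
    show "openin sep_topology (topspace sep_topology \<inter> f -` V)"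
      by (rule openin_union_of_cylinders[OF C(1)]) (auto simp: f_def agree_def split: if_splits)
  qed (auto simp: f_def)
  moreover have "f x = 0" "f ` S \<subseteq> {1}"
    using C(2) by (auto simp: f_def agree_refl)
  ultimately show "\<exists>f. continuous_map sep_topology (top_of_set {0..1::real}) f \<and> f x = 0 \<and> f ` S \<subseteq> {1}"
    by blast
qed

text \<open>Smallness of \<open>F\<close> admits the single coordinate \<open>(F, x)\<close>, which
  was modified precisely to separate \<open>x\<close> from \<open>F\<close>.\<close>

lemma closedin_small:
  assumes "small F"
  shows "closedin sep_topology F"
proof -
  have "\<exists>C. admissible C \<and> agree C x \<subseteq> UNIV - F" if "x \<in> UNIV - F" for x
  proof -
    have "admissible {(F, x)}"
      using assms by (simp add: admissible_def)
    moreover have "agree {(F, x)} x \<subseteq> UNIV - F"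
      using that by (auto simp: agree_def sep_def)
    ultimately show ?thesis by blast
  qed
  then show ?thesis
    by (simp add: closedin_def openin_sep_topology)
qed

lemma Hausdorff_sep_topology: "Hausdorff_space sep_topology"
  unfolding Hausdorff_space_def
proof (intro allI impI)
  fix x y assume "x \<in> topspace sep_topology \<and> y \<in> topspace sep_topology \<and> x \<noteq> y"
  then have "x \<noteq> y" by simp
  let ?C = "{({y}, x)}"
  have "admissible ?C"
    using small_singleton by (simp add: admissible_def)
  moreover have "disjnt (agree ?C x) (agree ?C y)"
    using \<open>x \<noteq> y\<close> by (auto simp: agree_def sep_def disjnt_iff)
  ultimately show "\<exists>U V. openin sep_topology U \<and> openin sep_topology V \<and> x \<in> U \<and> y \<in> V \<and> disjnt U V"
    using openin_agree agree_refl by metis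
qed

lemma P_space_sep_topology: "P_space sep_topology"
  unfolding P_space_def gdelta_in_def
proof (intro allI impI)
  fix S assume "((countable intersection_of openin sep_topology) relative_to topspace sep_topology) S"
  then obtain \<U> where \<U>: "countable \<U>" "\<And>U. U \<in> \<U> \<Longrightarrow> openin sep_topology U" "S = \<Inter>\<U>"
    by (auto simp: relative_to_def intersection_of_def)
  show "openin sep_topology S"
    unfolding openin_sep_topology
  proof
    fix x assume "x \<in> S"
    then have "\<forall>U\<in>\<U>. \<exists>C. admissible C \<and> agree C x \<subseteq> U"
      using \<U> unfolding openin_sep_topology by blast
    then obtain C where C: "\<And>U. U \<in> \<U> \<Longrightarrow> admissible (C U)" "\<And>U. U \<in> \<U> \<Longrightarrow> agree (C U) x \<subseteq> U"
      by metis
    have "agree (\<Union>U\<in>\<U>. C U) x \<subseteq> S"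
      unfolding \<U>(3)
    proof (rule Inter_greatest)
      fix U assume "U \<in> \<U>"
      then have "agree (\<Union>U\<in>\<U>. C U) x \<subseteq> agree (C U) x"
        by (intro agree_mono) blast
      then show "agree (\<Union>U\<in>\<U>. C U) x \<subseteq> U"
        using C(2)[OF \<open>U \<in> \<U>\<close>] by blast
    qed
    moreover have "admissible (\<Union>U\<in>\<U>. C U)"
      using \<U>(1) C(1) by (intro admissible_UN)
    ultimately show "\<exists>C. admissible C \<and> agree C x \<subseteq> S" by blast
  qed
qed

section \<open>Closures and failure of the weak Whyburn property\<close>

lemma closure_of_sep_topology:
  "x \<in> sep_topology closure_of F \<longleftrightarrow> (\<forall>C. admissible C \<longrightarrow> agree C x \<inter> F \<noteq> {})"
proof
  assume "x \<in> sep_topology closure_of F"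
  then show "\<forall>C. admissible C \<longrightarrow> agree C x \<inter> F \<noteq> {}"
    using openin_agree agree_refl unfolding in_closure_of by (metis disjoint_iff)
next
  assume *: "\<forall>C. admissible C \<longrightarrow> agree C x \<inter> F \<noteq> {}"
  have "\<exists>y. y \<in> F \<and> y \<in> U" if U: "x \<in> U" "openin sep_topology U" for U
  proof -
    obtain C where "admissible C" "agree C x \<subseteq> U"
      using U unfolding openin_sep_topology by blast
    then show ?thesis
      using * by blast
  qed
  then show "x \<in> sep_topology closure_of F"
    by (simp add: in_closure_of)
qed

text \<open>Take a \<open>p\<close> refuting smallness and keep its small indices. The values on an
  admissible \<open>C\<close> of a point \<open>x\<close> realizing these cannot clash with
  \<open>p\<close>, not even with its discarded part, so by choice of \<open>p\<close> some point of
  \<open>F\<close> shares them.\<close>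

lemma closure_not_small:
  assumes "\<not> small F"
  shows "\<exists>p. countable p \<and> single_valued p \<and> (\<forall>z\<in>p. small (fst (fst z))) \<and>
    (\<forall>x. (\<forall>z\<in>p. sep (fst z) x = snd z) \<longrightarrow> x \<in> sep_topology closure_of F)"
proof -
  obtain p where p: "countable p" "single_valued p"
    and "\<not> (\<exists>q. countable q \<and> single_valued (p \<union> q) \<and> (\<forall>z\<in>q. small (fst (fst z))) \<and>
      (\<forall>y\<in>F. \<exists>z\<in>q. sep (fst z) y \<noteq> snd z))"
  proof (rule ccontr)
    assume no: "\<not> thesis"
    have "small F"
    proof (rule smallI, rule ccontr)
      fix p :: "(('a set \<times> 'a) \<times> bool) set"
      assume "countable p" "single_valued p"
        and "\<not> (\<exists>q. countable q \<and> single_valued (p \<union> q) \<and> (\<forall>z\<in>q. small (fst (fst z))) \<and>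
          (\<forall>y\<in>F. \<exists>z\<in>q. sep (fst z) y \<noteq> snd z))"
      with that have thesis .
      with no show False ..
    qed
    with assms show False ..
  qed
  then have no_q: "\<exists>y\<in>F. \<forall>z\<in>q. sep (fst z) y = snd z"
    if "countable q" "single_valued (p \<union> q)" "\<forall>z\<in>q. small (fst (fst z))" for q
    using that by auto
  let ?p = "{z \<in> p. small (fst (fst z))}"
  have "x \<in> sep_topology closure_of F" if x: "\<And>z. z \<in> ?p \<Longrightarrow> sep (fst z) x = snd z" for x
    unfolding closure_of_sep_topology
  proof (intro allI impI)
    fix C assume C: "admissible C"
    let ?q = "(\<lambda>i. (i, sep i x)) ` C"
    have "single_valued (p \<union> ?q)"
    proof (rule single_valuedI)
      fix i b b' assume *: "(i, b) \<in> p \<union> ?q" "(i, b') \<in> p \<union> ?q"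
      have "b = sep i x" if "(i, b) \<in> p" "i \<in> C" for i b
        using that x[of "(i, b)"] C by (auto simp: admissible_def)
      then show "b = b'"
        using * single_valuedD[OF p(2)] by blast
    qed
    then have "\<exists>y\<in>F. \<forall>z\<in>?q. sep (fst z) y = snd z"
      using C by (intro no_q) (auto simp: admissible_def)
    then show "agree C x \<inter> F \<noteq> {}"
      by (auto simp: agree_def)
  qed
  moreover have "countable ?p" "single_valued ?p"
    using p by (auto intro: single_valued_subset[of ?p p])
  ultimately show ?thesis
    by (intro exI[of _ ?p]) blast
qed

lemma not_weakly_Whyburn_sep_topology: "\<not> weakly_Whyburn_space sep_topology"
proof
  assume W: "weakly_Whyburn_space sep_topology"
  have "\<exists>x. x \<in> sep_topology closure_of A - A"
  proof -
    obtain x where "x \<in> -A"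
      using independent[of "-A" "{}" "{}"] by auto
    moreover have "x \<in> sep_topology closure_of A"
      unfolding closure_of_sep_topology
    proof (intro allI impI)
      fix C assume C: "admissible C"
      \<comment> \<open>Every cylinder meets \<open>A\<close>, so \<open>A\<close> is dense; its
        complement being nonempty, \<open>A\<close> is not closed.\<close>
      have "\<exists>y\<in>A - {}. \<forall>z\<in>(\<lambda>i. (i, sep i x)) ` C. sep (fst z) y = snd z"
        using C by (intro small_cylinder_nonempty) (auto simp: admissible_def single_valued_def)
      then show "agree C x \<inter> A \<noteq> {}"
        by (auto simp: agree_def)
    qed
    ultimately show ?thesis by blast
  qed
  then have "\<not> closedin sep_topology A"
    using closure_of_closedin by fastforce
  then obtain x F where F: "F \<subseteq> A" "sep_topology closure_of F - F = {x}"
    using W unfolding weakly_Whyburn_space_def almost_closed_converging_def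
    by (metis subset_UNIV topspace_sep_topology)
  then have "\<not> small F"
    using closedin_small closure_of_closedin by fastforce
  then obtain p where p: "countable p" "single_valued p" "\<And>z. z \<in> p \<Longrightarrow> small (fst (fst z))"
    and cl: "\<And>y. \<forall>z\<in>p. sep (fst z) y = snd z \<Longrightarrow> y \<in> sep_topology closure_of F"
    using closure_not_small[OF \<open>\<not> small F\<close>] by (elim exE conjE) simp
  \<comment> \<open>The cylinder inside the closure of \<open>F\<close> also meets the complement of
    \<open>A\<close> away from \<open>x\<close>, giving a second point of the closure outside
    \<open>F\<close>.\<close>
  obtain y where "y \<in> -A - {x}" "\<forall>z\<in>p. sep (fst z) y = snd z"
    using small_cylinder_nonempty[OF p, of "-A" "{x}"] by auto
  then show False
    using cl F by blast
qed

end

theorem mainTheorem1: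
  shows "\<exists>X :: real topology.
           completely_regular_space X \<and> Hausdorff_space X \<and> P_space X \<and>
           topspace X \<approx> (UNIV :: real set) \<and>
           \<not> weakly_Whyburn_space X"
proof -
  obtain e :: "real set \<times> real \<Rightarrow> real \<Rightarrow> bool" and A
    where "\<forall>S\<in>{A, -A}. \<forall>p Z. countable p \<and> single_valued p \<and> countable Z \<longrightarrow>
      (\<exists>y\<in>S - Z. \<forall>(i, b)\<in>p. e i y = b)"
    using countably_independent_family_real by blast
  then interpret countably_independent e A
    by unfold_locales blast
  show ?thesis
    using completely_regular_sep_topology Hausdorff_sep_topology P_space_sep_topology
      not_weakly_Whyburn_sep_topology by (intro exI[of _ sep_topology]) simp
qed

end
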